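(* Let $H\in(0,1/2)$ and $\alpha\in(0,1]$ with $\alpha\ge 2H$. Let $B_H$ be a fractional Brownian motion with Hurst parameter $H$ and let $S_\alpha$ be a subordinator, independent of $B_H$, with $\mathbb{E}e^{-\eta S_\alpha(t)}=e^{-t\alpha\gamma(\alpha;\eta)}$, $\eta,t\ge0$. Put $Z_H(t)=B_H(S_\alpha(t))$. Then $$\mathrm{Var}(Z_H(t))\simeq K\,t^{2H/\alpha},\qquad t\to+\infty,$$ where $K$ is a constant depending on $\alpha$ and $H$, and therefore $Z_H$ behaves asymptotically as a subdiffusion, according to the parameter $\alpha$: $2H/\alpha$ is always less than one (since, by assumption, $2H\le\alpha$), and the subdiffusive behavior is more marked the greater the value of $\alpha$, for any fixed $H$.
   Context: $\gamma(\alpha;x)=\int_0^x e^{-w}w^{\alpha-1}\,dw$ is the lower-incomplete gamma function. A subordinator is a Lévy process with non-decreasing paths. The fractional Brownian motion $B_H$ is the zero-mean Gaussian, $H$-self-similar process with stationary increments, normalized so that $B_H(t)$ has variance $t^{2H}$. The symbol $\simeq$ denotes asymptotic equivalence. A process is subdiffusive if, for large times $t$, its mean square displacement grows as $t^{\gamma}$ with $\gamma<1$.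
   Formalization: The case α=2H is excluded from the claims: there 2H/α=1 and Var(Z_H(t)) is infinite, which is stated instead. B_H is taken with continuous paths, and path properties hold for every path; without continuity the law of B_H(S_α(t)) is not determined by the given properties. *)

theory Defs
  imports "HOL-Probability.Probability" "HOL-Library.Landau_Symbols"
begin

text \<open>
  Processes are functions of type \<open>real \<Rightarrow> 'a \<Rightarrow> real\<close> whose time variable ranges over \<open>{0..}\<close>;
  values at negative times are irrelevant.  Path properties (continuity, monotonicity) are
  required of every path.
\<close>

definition lower_incomplete_gamma :: "real \<Rightarrow> real \<Rightarrow> real" where
  "lower_incomplete_gamma a x = (LINT w:{0..x}|lborel. exp (- w) * w powr (a - 1))"

definition path_of :: "(real \<Rightarrow> 'a \<Rightarrow> real) \<Rightarrow> real set \<Rightarrow> 'a \<Rightarrow> real \<Rightarrow> real" where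
  "path_of X J \<omega> = (\<lambda>t\<in>J. X t \<omega>)"

definition same_fdd :: "'a measure \<Rightarrow> (real \<Rightarrow> 'a \<Rightarrow> real) \<Rightarrow> (real \<Rightarrow> 'a \<Rightarrow> real) \<Rightarrow> bool" where
  "same_fdd M X Y \<longleftrightarrow> (\<forall>J. finite J \<and> J \<subseteq> {0..} \<longrightarrow>
     distr M (PiM J (\<lambda>_. borel)) (path_of X J) = distr M (PiM J (\<lambda>_. borel)) (path_of Y J))"

definition independent_processes ::
    "'a measure \<Rightarrow> (real \<Rightarrow> 'a \<Rightarrow> real) \<Rightarrow> (real \<Rightarrow> 'a \<Rightarrow> real) \<Rightarrow> bool" where
  "independent_processes M X Y \<longleftrightarrow>
     prob_space.indep_var M (PiM {0..} (\<lambda>_. borel)) (path_of X {0..})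
                            (PiM {0..} (\<lambda>_. borel)) (path_of Y {0..})"

text \<open>Degenerate (almost surely constant) variables count as Gaussian.\<close>

definition gaussian_rv :: "'a measure \<Rightarrow> ('a \<Rightarrow> real) \<Rightarrow> bool" where
  "gaussian_rv M X \<longleftrightarrow> X \<in> borel_measurable M \<and>
     ((\<exists>\<mu> \<sigma>. 0 < \<sigma> \<and> distributed M lborel X (normal_density \<mu> \<sigma>)) \<or>
      (\<exists>c. AE \<omega> in M. X \<omega> = c))"

definition gaussian_process :: "'a measure \<Rightarrow> (real \<Rightarrow> 'a \<Rightarrow> real) \<Rightarrow> bool" where
  "gaussian_process M X \<longleftrightarrow> (\<forall>J a. finite J \<and> J \<subseteq> {0..} \<longrightarrow>
     gaussian_rv M (\<lambda>\<omega>. \<Sum>t\<in>J. a t * X t \<omega>))"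

text \<open>
  Continuity of the paths is the usual choice of version.  It cannot be dropped when the process
  is evaluated at a random time: the finite-dimensional distributions of the process, even
  jointly with the independent random time, do not determine the law of the composition.
\<close>

definition fractional_brownian_motion :: "'a measure \<Rightarrow> real \<Rightarrow> (real \<Rightarrow> 'a \<Rightarrow> real) \<Rightarrow> bool" where
  "fractional_brownian_motion M H B \<longleftrightarrow>
     gaussian_process M B \<and>
     (\<forall>t\<ge>0. prob_space.expectation M (B t) = 0) \<and>
     (\<forall>c>0. same_fdd M (\<lambda>t. B (c * t)) (\<lambda>t \<omega>. c powr H * B t \<omega>)) \<and>
     (\<forall>h\<ge>0. same_fdd M (\<lambda>t \<omega>. B (t + h) \<omega> - B h \<omega>) (\<lambda>t \<omega>. B t \<omega> - B 0 \<omega>)) \<and>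
     (\<forall>t\<ge>0. prob_space.variance M (B t) = t powr (2 * H)) \<and>
     (\<forall>\<omega>\<in>space M. continuous_on {0..} (\<lambda>t. B t \<omega>))"

definition levy_process :: "'a measure \<Rightarrow> (real \<Rightarrow> 'a \<Rightarrow> real) \<Rightarrow> bool" where
  "levy_process M X \<longleftrightarrow>
     (\<forall>t\<ge>0. X t \<in> borel_measurable M) \<and>
     (\<forall>\<omega>\<in>space M. X 0 \<omega> = 0) \<and>
     (\<forall>(\<tau> :: nat \<Rightarrow> real) n. 0 \<le> \<tau> 0 \<and> mono \<tau> \<longrightarrow>
        prob_space.indep_vars M (\<lambda>_. borel) (\<lambda>i \<omega>. X (\<tau> (Suc i)) \<omega> - X (\<tau> i) \<omega>) {..<n}) \<and>
     (\<forall>s\<ge>0. \<forall>t\<ge>0. distr M borel (\<lambda>\<omega>. X (s + t) \<omega> - X s \<omega>) = distr M borel (X t)) \<and>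
     (\<forall>\<omega>\<in>space M. (\<forall>t\<ge>0. ((\<lambda>s. X s \<omega>) \<longlongrightarrow> X t \<omega>) (at_right t)) \<and>
                   (\<forall>t>0. \<exists>l. ((\<lambda>s. X s \<omega>) \<longlongrightarrow> l) (at_left t)))"

definition subordinator :: "'a measure \<Rightarrow> (real \<Rightarrow> 'a \<Rightarrow> real) \<Rightarrow> bool" where
  "subordinator M S \<longleftrightarrow> levy_process M S \<and> (\<forall>\<omega>\<in>space M. mono_on {0..} (\<lambda>t. S t \<omega>))"

definition mean_square_displacement :: "'a measure \<Rightarrow> (real \<Rightarrow> 'a \<Rightarrow> real) \<Rightarrow> real \<Rightarrow> real" where
  "mean_square_displacement M Z t = prob_space.expectation M (\<lambda>\<omega>. (Z t \<omega> - Z 0 \<omega>)\<^sup>2)"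

text \<open>
  Requiring \<open>C > 0\<close> also rules out a displacement that is not square integrable, whose Bochner
  integral would be \<open>0\<close> by convention.
\<close>

definition has_msd_exponent :: "'a measure \<Rightarrow> (real \<Rightarrow> 'a \<Rightarrow> real) \<Rightarrow> real \<Rightarrow> bool" where
  "has_msd_exponent M Z \<gamma> \<longleftrightarrow>
     (\<exists>C>0. mean_square_displacement M Z \<sim>[at_top] (\<lambda>t. C * t powr \<gamma>))"

definition subdiffusive :: "'a measure \<Rightarrow> (real \<Rightarrow> 'a \<Rightarrow> real) \<Rightarrow> bool" where
  "subdiffusive M Z \<longleftrightarrow> (\<exists>\<gamma>. 0 < \<gamma> \<and> \<gamma> < 1 \<and> has_msd_exponent M Z \<gamma>)"

end

(* Conditioning on S turns the second moment of B(S(t)) into E S(t)^p with p = 2H.  For 0 < p < 1,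
   s^p times int_0^inf (1 - e^(-u)) u^(-p-1) du equals int_0^inf (1 - e^(-su)) u^(-p-1) du, so this
   fractional moment is read off the Laplace exponent t alpha gamma(alpha; u).  After the substitution
   u -> t^(-1/alpha) u the exponent lies below u^alpha and tends to it as t -> infinity; when
   p < alpha, min(1, u^alpha) u^(-p-1) dominates, which gives
   K = int_0^inf (1 - e^(-u^alpha)) u^(-p-1) du / int_0^inf (1 - e^(-u)) u^(-p-1) du.
   When p = alpha the integrand before rescaling is of order 1/u near 0 and the moment is infinite. *)
theory Submission
  imports Defs
begin

section \<open>Size and measurability of the incomplete gamma function\<close>

text \<open>For w in \<open>{0..x}\<close> the factor exp(-w) lies between exp(-x) and 1, and
  w^(a-1) integrates to x^a / a. The two bounds agree to leading order as x tends to 0, the regime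
  that governs large times.\<close>

lemma lower_incomplete_gamma_bounds:
  fixes a x :: real
  assumes a: "0 < a" and x: "0 \<le> x"
  shows "exp (- x) * x powr a \<le> a * lower_incomplete_gamma a x"
    and "a * lower_incomplete_gamma a x \<le> x powr a"
proof -
  have hi: "((\<lambda>w. w powr (a - 1)) has_integral x powr a / a) {0..x}"
    using has_integral_powr_from_0[of "a - 1" x] a x by simp
  have nn: "(\<integral>\<^sup>+w. ennreal (indicator {0..x} w * w powr (a - 1)) \<partial>lborel) = ennreal (x powr a / a)"
    by (rule nn_integral_has_integral_lebesgue[OF _ hi]) auto
  have int: "integrable lborel (\<lambda>w. indicator {0..x} w * w powr (a - 1))"
    by (rule integrableI_nn_integral_finite[OF _ _ nn]) (use a in auto)
  have eq: "(LINT w|lborel. indicator {0..x} w * w powr (a - 1)) = x powr a / a"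
    using nn a by (subst integral_eq_nn_integral) auto
  have intg: "integrable lborel (\<lambda>w. indicator {0..x} w * (exp (- w) * w powr (a - 1)))"
    by (rule Bochner_Integration.integrable_bound[OF int])
       (auto simp: indicator_def mult_left_le_one_le)
  have lig: "lower_incomplete_gamma a x
      = (LINT w|lborel. indicator {0..x} w * (exp (- w) * w powr (a - 1)))"
    by (simp add: lower_incomplete_gamma_def set_lebesgue_integral_def)
  have "lower_incomplete_gamma a x \<le> (LINT w|lborel. indicator {0..x} w * w powr (a - 1))"
    unfolding lig
    by (rule integral_mono[OF intg int]) (auto simp: indicator_def mult_left_le_one_le)
  then show "a * lower_incomplete_gamma a x \<le> x powr a"
    using a by (simp add: eq field_simps)
  have "exp (- x) * (LINT w|lborel. indicator {0..x} w * w powr (a - 1))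
      = (LINT w|lborel. exp (- x) * (indicator {0..x} w * w powr (a - 1)))"
    by simp
  also have "\<dots> \<le> lower_incomplete_gamma a x"
    unfolding lig
    by (rule integral_mono[OF _ intg]) (use int in \<open>auto simp: indicator_def mult_right_mono\<close>)
  finally show "exp (- x) * x powr a \<le> a * lower_incomplete_gamma a x"
    using a by (simp add: eq field_simps)
qed

lemma borel_measurable_lower_incomplete_gamma [measurable]:
  "lower_incomplete_gamma a \<in> borel_measurable borel"
proof -
  \<comment> \<open>The variable endpoint moves into the integrand, so that measurability of an
    integral depending on a parameter applies.\<close>
  have "lower_incomplete_gamma a
      = (\<lambda>x. LINT w|lborel. (if 0 \<le> w \<and> w \<le> x then exp (- w) * w powr (a - 1) else 0))"
    by (auto simp: lower_incomplete_gamma_def set_lebesgue_integral_def indicator_def fun_eq_iff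
             intro!: Bochner_Integration.integral_cong)
  also have "\<dots> \<in> borel_measurable borel"
    by measurable
  finally show ?thesis .
qed

section \<open>The kernel behind fractional moments: scaling, integrability, positivity\<close>

text \<open>For 0 < p < 1 and \<open>g u = u\<close> the integral over the line is Gamma(1-p)/p;
  below, only its finiteness and positivity are used. In the other instances \<open>g\<close> is
  \<open>s * u\<close>, a Laplace exponent, its rescaling, or the limit u^a.\<close>

definition frac_kernel :: "real \<Rightarrow> (real \<Rightarrow> real) \<Rightarrow> real \<Rightarrow> real" where
  "frac_kernel p g u = indicator {0<..} u * ((1 - exp (- g u)) * u powr (- p - 1))"

lemma borel_measurable_frac_kernel [measurable]:
  assumes [measurable]: "g \<in> borel_measurable borel"
  shows "frac_kernel p g \<in> borel_measurable borel"
  unfolding frac_kernel_def by measurable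

lemma frac_kernel_nonneg: "(\<And>u. u > 0 \<Longrightarrow> 0 \<le> g u) \<Longrightarrow> 0 \<le> frac_kernel p g u"
  by (auto simp: frac_kernel_def indicator_def)

text \<open>Substituting s u for u, the Jacobian and the factor u^(-p-1) together contribute s^p.
  Stated in [0, inf], it also covers divergent integrals. It is applied once with s a value of the
  random variable and once with s = t^(-1/a).\<close>

lemma nn_integral_frac_kernel_scale:
  assumes [measurable]: "g \<in> borel_measurable borel" and s: "s > 0"
  shows "(\<integral>\<^sup>+u. frac_kernel p (\<lambda>u. g (s * u)) u \<partial>lborel)
       = ennreal (s powr p) * (\<integral>\<^sup>+u. frac_kernel p g u \<partial>lborel)"
proof -
  \<comment> \<open>The form \<open>0 + s * u\<close> matches the affine change of variables used
    below.\<close>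
  have *: "frac_kernel p (\<lambda>u. g (s * u)) u = s powr p * (s * frac_kernel p g (0 + s * u))" for u
  proof (cases "u > 0")
    case True
    have "s powr p * (s * s powr (- p - 1)) = 1"
      using s by (simp add: powr_diff powr_minus)
    then show ?thesis
      using True s by (simp add: frac_kernel_def powr_mult mult.assoc mult.left_commute)
  next
    case False
    then show ?thesis
      using s by (simp add: frac_kernel_def indicator_def zero_less_mult_iff)
  qed
  have "(\<integral>\<^sup>+u. frac_kernel p (\<lambda>u. g (s * u)) u \<partial>lborel)
      = (\<integral>\<^sup>+u. ennreal (s powr p) * (ennreal s * ennreal (frac_kernel p g (0 + s * u))) \<partial>lborel)"
    unfolding * using s by (simp add: ennreal_mult')
  also have "\<dots> = ennreal (s powr p) * (ennreal \<bar>s\<bar> * (\<integral>\<^sup>+u. frac_kernel p g (0 + s * u) \<partial>lborel))"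
    using s by (simp add: nn_integral_cmult)
  also have "\<dots> = ennreal (s powr p) * (\<integral>\<^sup>+u. frac_kernel p g u \<partial>lborel)"
    using s by (subst nn_integral_real_affine[of "\<lambda>u. ennreal (frac_kernel p g u)" s 0]) auto
  finally show ?thesis .
qed

text \<open>Near 0 the function is u^(a-p-1), integrable because p < a; beyond 1 it is u^(-p-1),
  integrable because p > 0. It later dominates the kernels of all rescaled exponents at
  once.\<close>

lemma integrable_frac_kernel_bound:
  fixes p a :: real
  assumes p: "0 < p" and a: "p < a"
  shows "integrable lborel (\<lambda>u. indicator {0<..} u * (min 1 (u powr a) * u powr (- p - 1)) :: real)"
proof -
  have hi1: "((\<lambda>u. u powr (a - p - 1)) has_integral 1 powr (a - p) / (a - p)) {0..1}"
    using has_integral_powr_from_0[of "a - p - 1" 1] a by simp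
  have hi2: "((\<lambda>u. u powr (- p - 1)) has_integral - (1 powr (- p)) / (- p)) {1..}"
    using has_integral_powr_to_inf[of "- p - 1" 1] p by simp
  have n1: "(\<integral>\<^sup>+u. ennreal (indicator {0..1} u * u powr (a - p - 1)) \<partial>lborel)
      = ennreal (1 powr (a - p) / (a - p))"
    by (rule nn_integral_has_integral_lebesgue[OF _ hi1]) auto
  have n2: "(\<integral>\<^sup>+u. ennreal (indicator {1..} u * u powr (- p - 1)) \<partial>lborel)
      = ennreal (- (1 powr (- p)) / (- p))"
    by (rule nn_integral_has_integral_lebesgue[OF _ hi2]) auto
  have i1: "integrable lborel (\<lambda>u::real. indicator {0..1} u * u powr (a - p - 1))"
    by (rule integrableI_nn_integral_finite[OF _ _ n1]) (use a in auto)
  have i2: "integrable lborel (\<lambda>u::real. indicator {1..} u * u powr (- p - 1))"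
    by (rule integrableI_nn_integral_finite[OF _ _ n2]) (use p in auto)
  show ?thesis
  proof (rule Bochner_Integration.integrable_bound[OF Bochner_Integration.integrable_add[OF i1 i2]])
    show "AE u in lborel. norm (indicator {0<..} u * (min 1 (u powr a) * u powr (- p - 1)))
        \<le> norm (indicator {0..1} u * u powr (a - p - 1) + indicator {1..} u * u powr (- p - 1))"
    proof (intro always_eventually allI)
      fix u :: real
      consider "u \<le> 0" | "0 < u" "u < 1" | "1 \<le> u" by linarith
      then show "norm (indicator {0<..} u * (min 1 (u powr a) * u powr (- p - 1)))
        \<le> norm (indicator {0..1} u * u powr (a - p - 1) + indicator {1..} u * u powr (- p - 1))"
      proof cases
        case 2
        then have "min 1 (u powr a) * u powr (- p - 1) \<le> u powr a * u powr (- p - 1)"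
          by (intro mult_right_mono) auto
        also have "\<dots> = u powr (a - p - 1)"
          by (simp flip: powr_add add: algebra_simps)
        finally show ?thesis using 2 by (simp add: abs_mult)
      next
        case 3
        have "min 1 (u powr a) * u powr (- p - 1) \<le> 1 * u powr (- p - 1)"
          by (intro mult_right_mono) auto
        then show ?thesis using 3 by (auto simp: abs_mult indicator_def add_increasing)
      qed auto
    qed
  qed measurable
qed

text \<open>Rests on 1 - exp(-x) being at most both 1 and x, taken at x =
  \<open>g u\<close>.\<close>

lemma frac_kernel_le:
  assumes "\<And>u. u > 0 \<Longrightarrow> 0 \<le> g u" and "\<And>u. u > 0 \<Longrightarrow> g u \<le> u powr a"
  shows "frac_kernel p g u \<le> indicator {0<..} u * (min 1 (u powr a) * u powr (- p - 1))"
proof (cases "u > 0")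
  case True
  have "1 - exp (- g u) \<le> g u" using exp_ge_add_one_self[of "- g u"] by linarith
  then have "1 - exp (- g u) \<le> min 1 (u powr a)" using assms(2)[OF True] by simp
  then show ?thesis using True by (simp add: frac_kernel_def mult_right_mono)
qed (simp add: frac_kernel_def)

lemma integrable_frac_kernel:
  assumes "0 < p" "p < a" and [measurable]: "g \<in> borel_measurable borel"
    and g: "\<And>u. u > 0 \<Longrightarrow> 0 \<le> g u" "\<And>u. u > 0 \<Longrightarrow> g u \<le> u powr a"
  shows "integrable lborel (frac_kernel p g)"
proof (rule Bochner_Integration.integrable_bound[OF integrable_frac_kernel_bound[OF assms(1,2)]])
  show "AE u in lborel. norm (frac_kernel p g u)
      \<le> norm (indicator {0<..} u * (min 1 (u powr a) * u powr (- p - 1)))"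
  proof (intro always_eventually allI)
    fix u
    show "norm (frac_kernel p g u)
      \<le> norm (indicator {0<..} u * (min 1 (u powr a) * u powr (- p - 1)))"
      using frac_kernel_le[OF g, where u = u and p = p] frac_kernel_nonneg[OF g(1), where u = u and p = p]
      by simp
  qed
qed measurable

text \<open>A nonnegative function with integral 0 vanishes almost everywhere, whereas this one is
  nonzero on the whole interval (0,1). Positivity is needed to divide by the normalizing integral
  and to obtain K > 0.\<close>

lemma integral_frac_kernel_pos:
  assumes int: "integrable lborel (frac_kernel p g)" and g: "\<And>u. u > 0 \<Longrightarrow> 0 < g u"
  shows "0 < (LINT u|lborel. frac_kernel p g u)"
proof -
  have nn: "0 \<le> frac_kernel p g u" for u
    by (rule frac_kernel_nonneg) (use g in \<open>auto intro: less_imp_le\<close>)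
  have "(LINT u|lborel. frac_kernel p g u) \<noteq> 0"
  proof
    assume "(LINT u|lborel. frac_kernel p g u) = 0"
    then have "AE u in lborel. frac_kernel p g u = 0"
      using integral_nonneg_eq_0_iff_AE[OF int] nn by auto
    moreover have "frac_kernel p g u \<noteq> 0" if "u > 0" for u
      using that g[OF that] by (simp add: frac_kernel_def)
    ultimately have "AE u in lborel. u \<notin> {0<..<1::real}"
      by (auto elim!: eventually_mono)
    then have "emeasure lborel {0<..<1::real} = 0"
      by (subst (asm) AE_iff_measurable[OF _ refl]) (auto simp: greaterThanLessThan_def Int_def)
    then show False by simp
  qed
  moreover have "0 \<le> (LINT u|lborel. frac_kernel p g u)"
    using nn by (intro integral_nonneg_AE) auto
  ultimately show ?thesis by linarith
qed

section \<open>Fractional moments from the Laplace transform\<close>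

text \<open>Scaling by s = X turns X^p times the constant into an integral of 1 - exp(-u X); Tonelli
  then brings the expectation inside, where the Laplace transform evaluates it. The product form in
  [0, inf] allows an infinite moment.\<close>

lemma nn_integral_powr_via_laplace:
  fixes X :: "'a \<Rightarrow> real"
  assumes "prob_space M" and [measurable]: "X \<in> borel_measurable M"
    and X: "\<And>\<omega>. \<omega> \<in> space M \<Longrightarrow> 0 \<le> X \<omega>"
    and lap: "\<And>u. u > 0 \<Longrightarrow> (LINT \<omega>|M. exp (- u * X \<omega>)) = exp (- g u)"
  shows "(\<integral>\<^sup>+\<omega>. ennreal (X \<omega> powr p) \<partial>M) * (\<integral>\<^sup>+u. frac_kernel p (\<lambda>u. u) u \<partial>lborel)
       = (\<integral>\<^sup>+u. frac_kernel p g u \<partial>lborel)"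
proof -
  interpret prob_space M by fact
  interpret P: pair_sigma_finite M lborel ..
  define c where "c = (\<integral>\<^sup>+u. frac_kernel p (\<lambda>u. u) u \<partial>lborel)"
  have *: "ennreal (X \<omega> powr p) * c = (\<integral>\<^sup>+u. frac_kernel p (\<lambda>u. X \<omega> * u) u \<partial>lborel)"
    if "\<omega> \<in> space M" for \<omega>
  \<comment> \<open>Scaling requires a positive factor. At \<open>X \<omega> = 0\<close> both sides
    are 0, since \<open>0 powr p = 0\<close>.\<close>
  proof (cases "X \<omega> = 0")
    case False
    then have "X \<omega> > 0" using X[OF that] by simp
    then show ?thesis
      using nn_integral_frac_kernel_scale[of "\<lambda>u. u" "X \<omega>" p] by (simp add: c_def)
  qed (simp add: frac_kernel_def)
  have "(\<integral>\<^sup>+\<omega>. ennreal (X \<omega> powr p) \<partial>M) * c = (\<integral>\<^sup>+\<omega>. ennreal (X \<omega> powr p) * c \<partial>M)"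
    by (simp add: nn_integral_multc)
  also have "\<dots> = (\<integral>\<^sup>+\<omega>. \<integral>\<^sup>+u. frac_kernel p (\<lambda>u. X \<omega> * u) u \<partial>lborel \<partial>M)"
    by (intro nn_integral_cong *)
  also have "\<dots> = (\<integral>\<^sup>+u. \<integral>\<^sup>+\<omega>. frac_kernel p (\<lambda>u. X \<omega> * u) u \<partial>M \<partial>lborel)"
    unfolding frac_kernel_def by (rule P.Fubini'[symmetric]) measurable
  also have "\<dots> = (\<integral>\<^sup>+u. frac_kernel p g u \<partial>lborel)"
  proof (rule nn_integral_cong)
    fix u :: real
    show "(\<integral>\<^sup>+\<omega>. frac_kernel p (\<lambda>u. X \<omega> * u) u \<partial>M) = frac_kernel p g u"
    proof (cases "u > 0")
      case True
      have int: "integrable M (\<lambda>\<omega>. exp (- u * X \<omega>))"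
        using True X by (intro integrable_const_bound[of _ 1]) auto
      have "(\<integral>\<^sup>+\<omega>. frac_kernel p (\<lambda>u. X \<omega> * u) u \<partial>M)
          = (\<integral>\<^sup>+\<omega>. ennreal ((1 - exp (- u * X \<omega>)) * u powr (- p - 1)) \<partial>M)"
        using True by (simp add: frac_kernel_def mult.commute)
      also have "\<dots> = ennreal (LINT \<omega>|M. (1 - exp (- u * X \<omega>)) * u powr (- p - 1))"
        using True X int by (intro nn_integral_eq_integral) (auto intro!: always_eventually)
      also have "(LINT \<omega>|M. (1 - exp (- u * X \<omega>)) * u powr (- p - 1))
          = (1 - exp (- g u)) * u powr (- p - 1)"
        using int lap[OF True] by (simp add: prob_space)
      finally show ?thesis using True by (simp add: frac_kernel_def)
    qed (simp add: frac_kernel_def)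
  qed
  finally show ?thesis by (simp add: c_def)
qed

section \<open>The rescaled Laplace exponent and its stable limit\<close>

text \<open>The Laplace exponent of t^(-1/a) S(t). The scaling is that of an a-stable subordinator,
  whose exponent u^a appears as the limit (a pure drift when a = 1).\<close>

definition rescaled_exponent :: "real \<Rightarrow> real \<Rightarrow> real \<Rightarrow> real" where
  "rescaled_exponent a t u = t * (a * lower_incomplete_gamma a (t powr (- 1 / a) * u))"

lemma borel_measurable_rescaled_exponent [measurable]:
  "rescaled_exponent a t \<in> borel_measurable borel"
  unfolding rescaled_exponent_def by measurable

text \<open>With v = t^(-1/a) u one has t v^a = u^a, so the factor t is absorbed exactly. The upper
  bound is therefore free of t, as dominated convergence needs.\<close>

lemma rescaled_exponent_bounds:
  assumes a: "0 < a" and t: "0 < t" and u: "0 < u"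
  shows "exp (- (t powr (- 1 / a) * u)) * u powr a \<le> rescaled_exponent a t u"
    and "rescaled_exponent a t u \<le> u powr a"
    and "0 \<le> rescaled_exponent a t u"
proof -
  define v where "v = t powr (- 1 / a) * u"
  have "0 \<le> v" using t u by (simp add: v_def)
  note b = lower_incomplete_gamma_bounds[OF a this]
  have "v powr a = t powr (- 1 / a * a) * u powr a"
    using t u by (simp only: v_def powr_mult powr_powr)
  then have tv: "t * v powr a = u powr a" using t a by (simp add: powr_minus)
  show "rescaled_exponent a t u \<le> u powr a"
    using mult_left_mono[OF b(2), of t] t tv by (simp only: rescaled_exponent_def v_def[symmetric])
  show lo: "exp (- (t powr (- 1 / a) * u)) * u powr a \<le> rescaled_exponent a t u"
    using mult_left_mono[OF b(1), of t] t
    by (simp only: rescaled_exponent_def v_def[symmetric] tv[symmetric]) (simp add: mult.left_commute)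
  show "0 \<le> rescaled_exponent a t u"
    by (rule order_trans[OF _ lo]) simp
qed

lemma tendsto_rescaled_exponent:
  assumes a: "0 < a" and u: "0 < u"
  shows "((\<lambda>t. rescaled_exponent a t u) \<longlongrightarrow> u powr a) at_top"
proof (rule tendsto_sandwich)
  show "\<forall>\<^sub>F t in at_top. exp (- (t powr (- 1 / a) * u)) * u powr a \<le> rescaled_exponent a t u"
    using eventually_gt_at_top[of 0] by eventually_elim (rule rescaled_exponent_bounds(1)[OF a _ u])
  show "\<forall>\<^sub>F t in at_top. rescaled_exponent a t u \<le> u powr a"
    using eventually_gt_at_top[of 0] by eventually_elim (rule rescaled_exponent_bounds(2)[OF a _ u])
  have "((\<lambda>t. t powr (- 1 / a)) \<longlongrightarrow> 0) at_top"
    using a by (intro tendsto_neg_powr filterlim_ident) auto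
  then have "((\<lambda>t. exp (- (t powr (- 1 / a) * u)) * u powr a)
      \<longlongrightarrow> exp (- (0 * u)) * u powr a) at_top"
    by (intro tendsto_intros)
  then show "((\<lambda>t. exp (- (t powr (- 1 / a) * u)) * u powr a) \<longlongrightarrow> u powr a) at_top"
    by simp
qed simp

text \<open>Dominated convergence along the real parameter t: the exponents converge pointwise and
  share the upper bound u^a, and p < a makes the resulting majorant integrable.\<close>

lemma tendsto_integral_frac_kernel_rescaled_exponent:
  assumes p: "0 < p" and a: "p < a"
  shows "((\<lambda>t. LINT u|lborel. frac_kernel p (rescaled_exponent a t) u)
          \<longlongrightarrow> (LINT u|lborel. frac_kernel p (\<lambda>u. u powr a) u)) at_top"
proof (rule integral_dominated_convergence_at_top[OF _ _ integrable_frac_kernel_bound[OF p a]])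
  have a0: "0 < a" using p a by simp
  show "\<forall>\<^sub>F t in at_top. AE u in lborel. norm (frac_kernel p (rescaled_exponent a t) u)
      \<le> indicator {0<..} u * (min 1 (u powr a) * u powr (- p - 1))"
    using eventually_gt_at_top[of 0]
  proof eventually_elim
    case (elim t)
    show ?case
    proof (intro always_eventually allI)
      fix u
      have "0 \<le> frac_kernel p (rescaled_exponent a t) u"
        by (rule frac_kernel_nonneg[OF rescaled_exponent_bounds(3)[OF a0 elim]])
      moreover have "frac_kernel p (rescaled_exponent a t) u
          \<le> indicator {0<..} u * (min 1 (u powr a) * u powr (- p - 1))"
        by (rule frac_kernel_le[OF rescaled_exponent_bounds(3)[OF a0 elim] rescaled_exponent_bounds(2)[OF a0 elim]])
      ultimately show "norm (frac_kernel p (rescaled_exponent a t) u)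
          \<le> indicator {0<..} u * (min 1 (u powr a) * u powr (- p - 1))" by simp
    qed
  qed
  show "AE u in lborel. ((\<lambda>t. frac_kernel p (rescaled_exponent a t) u) \<longlongrightarrow> frac_kernel p (\<lambda>u. u powr a) u) at_top"
  proof (intro always_eventually allI)
    fix u :: real
    show "((\<lambda>t. frac_kernel p (rescaled_exponent a t) u) \<longlongrightarrow> frac_kernel p (\<lambda>u. u powr a) u) at_top"
    proof (cases "u > 0")
      case True
      then show ?thesis unfolding frac_kernel_def by (intro tendsto_intros tendsto_rescaled_exponent a0)
    qed (simp add: frac_kernel_def)
  qed
qed measurable

section \<open>Divergence in the boundary case p = a\<close>

text \<open>On [exp(-n), 1] the integral of 1/u is exactly n, so the full integral exceeds every
  natural number.\<close>

lemma nn_integral_inverse_0_1: "(\<integral>\<^sup>+u. ennreal (indicator {0<..1} u * (1 / u)) \<partial>lborel) = \<infinity>"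
proof -
  have "of_nat n \<le> (\<integral>\<^sup>+u. ennreal (indicator {0<..1} u * (1 / u)) \<partial>lborel)" for n :: nat
  proof -
    have pos: "0 < x" if "exp (- real n) \<le> x" for x
      using that exp_gt_zero by (rule less_le_trans[rotated])
    have "(\<integral>\<^sup>+u. ennreal (1 / u) * indicator {exp (- real n)..1} u \<partial>lborel)
        = ennreal (ln 1 - ln (exp (- real n)))"
      by (rule nn_integral_FTC_Icc)
         (auto intro!: derivative_eq_intros less_imp_le dest!: pos)
    moreover have "(\<integral>\<^sup>+u. ennreal (1 / u) * indicator {exp (- real n)..1} u \<partial>lborel)
        \<le> (\<integral>\<^sup>+u. ennreal (indicator {0<..1} u * (1 / u)) \<partial>lborel)"
      by (rule nn_integral_mono) (auto simp: indicator_def dest: pos)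
    ultimately show ?thesis by (simp add: ennreal_of_nat_eq_real_of_nat)
  qed
  then have "\<not> (\<integral>\<^sup>+u. ennreal (indicator {0<..1} u * (1 / u)) \<partial>lborel) < \<top>"
    using ennreal_Ex_less_of_nat leD by blast
  then show ?thesis by (simp only: less_top[symmetric] not_not infinity_ennreal_def)
qed

text \<open>On (0,1] the exponent is at least k u^a with k = t/e, because exp(-u) is at least
  exp(-1) there. The factor u^a cancels against u^(-a-1), leaving a positive multiple of 1/u as a
  minorant.\<close>

lemma nn_integral_frac_kernel_tempered_infinite:
  assumes a: "0 < a" and t: "0 < t"
  shows "(\<integral>\<^sup>+u. frac_kernel a (\<lambda>u. t * (a * lower_incomplete_gamma a u)) u \<partial>lborel) = \<infinity>"
proof -
  define k where "k = t * exp (- 1)"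
  have k: "k > 0" using t by (simp add: k_def)
  have le: "k / (1 + k) * (indicator {0<..1} u * (1 / u))
      \<le> frac_kernel a (\<lambda>u. t * (a * lower_incomplete_gamma a u)) u" for u :: real
  proof (cases "0 < u \<and> u \<le> 1")
    case True
    define x where "x = k * u powr a"
    have x: "0 \<le> x" "x \<le> k"
      using True k a by (auto simp: x_def powr_le1 mult_left_le)
    have "x \<le> t * (a * lower_incomplete_gamma a u)"
    proof -
      have "exp (- 1) * u powr a \<le> exp (- u) * u powr a"
        using True by (intro mult_right_mono) auto
      also have "\<dots> \<le> a * lower_incomplete_gamma a u"
        using True by (intro lower_incomplete_gamma_bounds a) auto
      finally show ?thesis using t by (simp add: x_def k_def mult.assoc)
    qed
    then have 1: "1 - exp (- x) \<le> 1 - exp (- (t * (a * lower_incomplete_gamma a u)))"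
      by simp
    \<comment> \<open>From exp x >= 1 + x follows 1 - exp(-x) >= x / (1 + x); since x <= k, the
      denominator may be replaced by the constant 1 + k.\<close>
    have 2: "k / (1 + k) * u powr a \<le> 1 - exp (- x)"
    proof -
      have "exp (- x) \<le> 1 / (1 + x)"
        using exp_ge_add_one_self[of x] x by (simp add: exp_minus field_simps)
      then have "x / (1 + x) \<le> 1 - exp (- x)"
        using x by (simp add: field_simps)
      moreover have "x / (1 + k) \<le> x / (1 + x)"
        using x by (intro divide_left_mono) auto
      ultimately show ?thesis by (simp add: x_def)
    qed
    have "k / (1 + k) * u powr a * u powr (- a - 1)
        \<le> (1 - exp (- (t * (a * lower_incomplete_gamma a u)))) * u powr (- a - 1)"
      by (intro mult_right_mono order_trans[OF 2 1]) auto
    moreover have "u powr a * u powr (- a - 1) = 1 / u"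
      using True by (simp add: powr_minus_divide flip: powr_add)
    ultimately show ?thesis
      using True by (simp add: frac_kernel_def mult.assoc mult.commute[of u])
  next
    case False
    have "0 \<le> frac_kernel a (\<lambda>u. t * (a * lower_incomplete_gamma a u)) u"
    proof (rule frac_kernel_nonneg)
      fix u :: real assume "u > 0"
      then show "0 \<le> t * (a * lower_incomplete_gamma a u)"
        using order_trans[OF _ lower_incomplete_gamma_bounds(1)[OF a, of u]] t by simp
    qed
    then show ?thesis using False by (auto simp: indicator_def)
  qed
  have "ennreal (k / (1 + k)) * (\<integral>\<^sup>+u. ennreal (indicator {0<..1} u * (1 / u)) \<partial>lborel)
      = (\<integral>\<^sup>+u. ennreal (k / (1 + k) * (indicator {0<..1} u * (1 / u))) \<partial>lborel)"
  proof -
    have "ennreal (k / (1 + k) * x) = ennreal (k / (1 + k)) * ennreal x" for x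
      using k by (intro ennreal_mult') simp
    then show ?thesis by (simp only:) (rule nn_integral_cmult[symmetric], measurable)
  qed
  also have "\<dots> \<le> (\<integral>\<^sup>+u. frac_kernel a (\<lambda>u. t * (a * lower_incomplete_gamma a u)) u \<partial>lborel)"
    by (intro nn_integral_mono ennreal_leI le)
  finally show ?thesis
    using k unfolding nn_integral_inverse_0_1 by (simp add: ennreal_mult_top top_unique)
qed

section \<open>A process evaluated at an independent random time\<close>

text \<open>Independence makes the joint law of the two paths a product. Once the composition is a
  measurable function of the pair of paths, Tonelli allows integrating over B with the random time
  frozen.\<close>

lemma nn_integral_process_at_random_time:
  fixes B S :: "real \<Rightarrow> 'a \<Rightarrow> real" and h :: "real \<Rightarrow> ennreal"
  assumes M: "prob_space M" and indep: "independent_processes M B S" and t: "0 \<le> t"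
    and S: "\<And>\<omega>. \<omega> \<in> space M \<Longrightarrow> 0 \<le> S t \<omega>"
    and cont: "\<And>\<omega>. \<omega> \<in> space M \<Longrightarrow> continuous_on {0..} (\<lambda>t. B t \<omega>)"
  shows "(\<lambda>\<omega>. B (S t \<omega>) \<omega>) \<in> borel_measurable M"
    and "h \<in> borel_measurable borel \<Longrightarrow>
      (\<integral>\<^sup>+\<omega>. h (B (S t \<omega>) \<omega>) \<partial>M) = (\<integral>\<^sup>+\<omega>'. (\<integral>\<^sup>+\<omega>. h (B (S t \<omega>') \<omega>) \<partial>M) \<partial>M)"
proof -
  interpret prob_space M by fact
  define N :: "(real \<Rightarrow> real) measure" where "N = PiM {0..} (\<lambda>_. borel)"
  have path [measurable]: "path_of B {0..} \<in> measurable M N" "path_of S {0..} \<in> measurable M N"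
    and joint: "distr M N (path_of B {0..}) \<Otimes>\<^sub>M distr M N (path_of S {0..})
      = distr M (N \<Otimes>\<^sub>M N) (\<lambda>\<omega>. (path_of B {0..} \<omega>, path_of S {0..} \<omega>))"
    using indep by (auto simp: independent_processes_def indep_var_distribution_eq N_def)
  have eval [measurable]: "(\<lambda>f. f s) \<in> borel_measurable N" if "0 \<le> s" for s
    unfolding N_def using that by (intro measurable_component_singleton) auto
  \<comment> \<open>Rounds s down to the grid of mesh 1/(n+1). Through \<open>nat\<close> the grid
    point is never negative, so it stays in the index set \<open>{0..}\<close>.\<close>
  define r where "r n s = real (nat \<lfloor>real (Suc n) * s\<rfloor>) / real (Suc n)" for n s
  \<comment> \<open>Evaluation of a path at a variable time is not measurable for the product sigma-algebra;
    for continuous paths it agrees with the measurable limit of evaluations along grids.\<close>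
  define F where "F = (\<lambda>(f :: real \<Rightarrow> real, s). lim (\<lambda>n. f (r n s)))"
  have F_meas [measurable]: "F \<in> borel_measurable (N \<Otimes>\<^sub>M borel)"
  proof -
    \<comment> \<open>The grid index takes countably many values, which reduces the claim to
      evaluation at fixed times.\<close>
    have "(\<lambda>x. fst x (r n (snd x))) \<in> borel_measurable (N \<Otimes>\<^sub>M borel)" for n
      unfolding r_def
    proof (rule measurable_compose_countable[of "\<lambda>k x. fst x (real k / real (Suc n))"
          "N \<Otimes>\<^sub>M borel" borel "\<lambda>x. nat \<lfloor>real (Suc n) * snd x\<rfloor>"])
      fix k :: nat
      show "(\<lambda>x. fst x (real k / real (Suc n))) \<in> borel_measurable (N \<Otimes>\<^sub>M borel)"
        by (rule measurable_compose[OF measurable_fst eval]) simp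
    qed measurable
    then show ?thesis unfolding F_def case_prod_beta by (rule borel_measurable_lim_metric)
  qed
  have r_tendsto: "(\<lambda>n. r n s) \<longlonglongrightarrow> s" if "0 \<le> s" for s
  proof (rule tendsto_sandwich[of "\<lambda>n. s - 1 / real (Suc n)" _ _ "\<lambda>_. s"])
    have *: "real (nat \<lfloor>real (Suc n) * s\<rfloor>) \<le> real (Suc n) * s"
      "real (Suc n) * s - 1 \<le> real (nat \<lfloor>real (Suc n) * s\<rfloor>)" for n
      using that by (auto simp del: of_nat_Suc)
    have "s - 1 / real (Suc n) \<le> r n s" "r n s \<le> s" for n
    proof -
      have "s - 1 / real (Suc n) = (real (Suc n) * s - 1) / real (Suc n)"
        by (simp add: diff_divide_distrib del: of_nat_Suc)
      also have "\<dots> \<le> r n s"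
        unfolding r_def by (intro divide_right_mono *) auto
      finally show "s - 1 / real (Suc n) \<le> r n s" .
      have "r n s \<le> real (Suc n) * s / real (Suc n)"
        unfolding r_def by (intro divide_right_mono *) auto
      then show "r n s \<le> s" by (simp del: of_nat_Suc)
    qed
    then show "\<forall>\<^sub>F n in sequentially. s - 1 / real (Suc n) \<le> r n s"
      "\<forall>\<^sub>F n in sequentially. r n s \<le> s"
      by auto
    have "(\<lambda>n. s - 1 / real (Suc n)) \<longlonglongrightarrow> s - 0"
      by (intro tendsto_diff tendsto_const LIMSEQ_Suc[OF lim_1_over_n])
    then show "(\<lambda>n. s - 1 / real (Suc n)) \<longlonglongrightarrow> s" by simp
  qed simp
  have F_eq: "F (path_of B {0..} \<omega>, s) = B s \<omega>" if "\<omega> \<in> space M" "0 \<le> s" for \<omega> s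
  proof -
    have "(\<lambda>n. B (r n s) \<omega>) \<longlonglongrightarrow> B s \<omega>"
      by (rule continuous_on_tendsto_compose[OF cont[OF that(1)] r_tendsto[OF that(2)]])
         (use that(2) in \<open>auto simp: r_def\<close>)
    moreover have "path_of B {0..} \<omega> (r n s) = B (r n s) \<omega>" for n
      by (simp add: path_of_def r_def)
    ultimately show ?thesis by (simp add: F_def limI)
  qed
  define G where "G = (\<lambda>(f, g). F (f, g t))"
  have G_meas [measurable]: "G \<in> borel_measurable (N \<Otimes>\<^sub>M N)"
    unfolding G_def using eval[OF t] by measurable
  \<comment> \<open>Two separate outcomes are allowed: the diagonal gives the composition, distinct
    outcomes the iterated integral.\<close>
  have G_eq: "G (path_of B {0..} \<omega>, path_of S {0..} \<omega>') = B (S t \<omega>') \<omega>"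
    if "\<omega> \<in> space M" "\<omega>' \<in> space M" for \<omega> \<omega>'
    using F_eq[OF that(1) S[OF that(2)]] t by (simp add: G_def path_of_def)
  have "(\<lambda>\<omega>. G (path_of B {0..} \<omega>, path_of S {0..} \<omega>)) \<in> borel_measurable M"
    by measurable
  then show "(\<lambda>\<omega>. B (S t \<omega>) \<omega>) \<in> borel_measurable M"
    by (rule measurable_cong[THEN iffD1, rotated]) (rule G_eq)
  assume h [measurable]: "h \<in> borel_measurable borel"
  interpret P1: prob_space "distr M N (path_of B {0..})" by (rule prob_space_distr) measurable
  interpret P2: prob_space "distr M N (path_of S {0..})" by (rule prob_space_distr) measurable
  interpret P: pair_sigma_finite "distr M N (path_of B {0..})" "distr M N (path_of S {0..})" ..
  have "(\<integral>\<^sup>+\<omega>. h (B (S t \<omega>) \<omega>) \<partial>M)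
      = (\<integral>\<^sup>+\<omega>. h (G (path_of B {0..} \<omega>, path_of S {0..} \<omega>)) \<partial>M)"
    by (intro nn_integral_cong) (simp add: G_eq)
  also have "\<dots> = (\<integral>\<^sup>+x. h (G x) \<partial>(distr M N (path_of B {0..}) \<Otimes>\<^sub>M distr M N (path_of S {0..})))"
    unfolding joint by (subst nn_integral_distr) measurable
  also have "\<dots> = (\<integral>\<^sup>+g. \<integral>\<^sup>+f. h (G (f, g)) \<partial>distr M N (path_of B {0..}) \<partial>distr M N (path_of S {0..}))"
    by (subst P.nn_integral_snd[symmetric]) auto
  also have "\<dots> = (\<integral>\<^sup>+\<omega>'. \<integral>\<^sup>+f. h (G (f, path_of S {0..} \<omega>')) \<partial>distr M N (path_of B {0..}) \<partial>M)"
    by (subst nn_integral_distr) auto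
  also have "\<dots> = (\<integral>\<^sup>+\<omega>'. \<integral>\<^sup>+\<omega>. h (G (path_of B {0..} \<omega>, path_of S {0..} \<omega>')) \<partial>M \<partial>M)"
    by (intro nn_integral_cong, subst nn_integral_distr) (auto intro!: measurable_compose[OF _ h])
  also have "\<dots> = (\<integral>\<^sup>+\<omega>'. \<integral>\<^sup>+\<omega>. h (B (S t \<omega>') \<omega>) \<partial>M \<partial>M)"
    by (intro nn_integral_cong) (simp add: G_eq)
  finally show "(\<integral>\<^sup>+\<omega>. h (B (S t \<omega>) \<omega>) \<partial>M) = (\<integral>\<^sup>+\<omega>'. (\<integral>\<^sup>+\<omega>. h (B (S t \<omega>') \<omega>) \<partial>M) \<partial>M)" .
qed

text \<open>The variance is a Bochner integral, which is 0 by convention for a non-integrable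
  function, so square integrability has to be derived from the definition.\<close>

lemma fractional_brownian_motion_marginal:
  assumes M: "prob_space M" and fbm: "fractional_brownian_motion M H B" and t: "0 \<le> t"
  shows "B t \<in> borel_measurable M"
    and "integrable M (B t)"
    and "(\<integral>\<omega>. B t \<omega> \<partial>M) = 0"
    and "(\<integral>\<^sup>+\<omega>. ennreal ((B t \<omega>)\<^sup>2) \<partial>M) = ennreal (t powr (2 * H))"
proof -
  interpret prob_space M by fact
  have exp0: "expectation (B t) = 0" and var: "variance (B t) = t powr (2 * H)"
    using fbm t unfolding fractional_brownian_motion_def by auto
  have "gaussian_rv M (\<lambda>\<omega>. \<Sum>s\<in>{t}. 1 * B s \<omega>)"
  proof -
    have "gaussian_process M B" using fbm by (simp add: fractional_brownian_motion_def)
    then show ?thesis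
      unfolding gaussian_process_def by (rule allE[of _ "{t}"], elim allE[of _ "\<lambda>_. 1"]) (use t in simp)
  qed
  then have g: "gaussian_rv M (B t)" by simp
  then show meas [measurable]: "B t \<in> borel_measurable M"
    by (simp add: gaussian_rv_def)
  have sq: "integrable M (\<lambda>\<omega>. (B t \<omega>)\<^sup>2)"
  \<comment> \<open>For t > 0 the integral is nonzero and hence genuine. At t = 0 the Gaussian
    property decides: variance 0 excludes a proper normal law and leaves an almost surely constant
    variable.\<close>
  proof (cases "t = 0")
    case False
    then have "expectation (\<lambda>\<omega>. (B t \<omega>)\<^sup>2) \<noteq> 0" using var exp0 by simp
    then show ?thesis by (rule contrapos_np) (rule not_integrable_integral_eq)
  next
    case True
    from g consider (normal) \<mu> \<sigma> where "0 < \<sigma>" "distributed M lborel (B t) (normal_density \<mu> \<sigma>)"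
      | (const) c where "AE \<omega> in M. B t \<omega> = c"
      unfolding gaussian_rv_def by blast
    then show ?thesis
    proof cases
      case normal
      then have "variance (B t) = \<sigma>\<^sup>2" by (rule normal_distributed_variance)
      then have "\<sigma>\<^sup>2 = 0" using var True by simp
      then show ?thesis using normal(1) by simp
    next
      case const
      then have "AE \<omega> in M. norm ((B t \<omega>)\<^sup>2) \<le> c\<^sup>2" by eventually_elim simp
      then show ?thesis by (intro integrable_const_bound) auto
    qed
  qed
  then show "integrable M (B t)" by (rule square_integrable_imp_integrable[OF meas])
  show "(\<integral>\<omega>. B t \<omega> \<partial>M) = 0" by (rule exp0)
  have "(\<integral>\<^sup>+\<omega>. ennreal ((B t \<omega>)\<^sup>2) \<partial>M) = ennreal (expectation (\<lambda>\<omega>. (B t \<omega>)\<^sup>2))"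
    by (rule nn_integral_eq_integral[OF sq]) auto
  then show "(\<integral>\<^sup>+\<omega>. ennreal ((B t \<omega>)\<^sup>2) \<partial>M) = ennreal (t powr (2 * H))"
    using var exp0 by simp
qed

text \<open>Since \<open>ennreal\<close> sends negative reals to 0, the two sides are the integrals
  of the positive and negative parts. This carries a zero mean through identities valid only for
  nonnegative integrands.\<close>

lemma integral_eq_0_iff_nn_integrals_eq:
  fixes f :: "'a \<Rightarrow> real"
  assumes "integrable M f"
  shows "(\<integral>x. f x \<partial>M) = 0 \<longleftrightarrow> (\<integral>\<^sup>+x. ennreal (f x) \<partial>M) = (\<integral>\<^sup>+x. ennreal (- f x) \<partial>M)"
proof -
  have "(\<integral>\<^sup>+x. ennreal (f x) \<partial>M) < \<top>" "(\<integral>\<^sup>+x. ennreal (- f x) \<partial>M) < \<top>"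
    using assms unfolding real_integrable_def by (auto simp: less_top)
  then have "enn2real (\<integral>\<^sup>+x. ennreal (f x) \<partial>M) = enn2real (\<integral>\<^sup>+x. ennreal (- f x) \<partial>M)
      \<longleftrightarrow> (\<integral>\<^sup>+x. ennreal (f x) \<partial>M) = (\<integral>\<^sup>+x. ennreal (- f x) \<partial>M)"
    using ennreal_enn2real by metis
  then show ?thesis
    unfolding real_lebesgue_integral_def[OF assms] by (simp only: right_minus_eq)
qed

lemma subordinator_nonneg:
  assumes "subordinator M S" "0 \<le> t" "\<omega> \<in> space M"
  shows "0 \<le> S t \<omega>"
  using assms mono_onD[of "{0..}" "\<lambda>t. S t \<omega>" 0 t]
  by (auto simp: subordinator_def levy_process_def)

text \<open>At a frozen time s the variable B(s) has second moment s^(2H) and mean 0. The mean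
  passes to the composition through its positive and negative parts, whose integrals agree at each
  frozen time.\<close>

lemma subordinated_fbm_moments:
  assumes M: "prob_space M" and fbm: "fractional_brownian_motion M H B"
    and S: "subordinator M S" and indep: "independent_processes M B S" and t: "0 \<le> t"
  shows "(\<lambda>\<omega>. B (S t \<omega>) \<omega>) \<in> borel_measurable M"
    and "(\<integral>\<^sup>+\<omega>. ennreal ((B (S t \<omega>) \<omega>)\<^sup>2) \<partial>M) = (\<integral>\<^sup>+\<omega>. ennreal (S t \<omega> powr (2 * H)) \<partial>M)"
    and "integrable M (\<lambda>\<omega>. (B (S t \<omega>) \<omega>)\<^sup>2) \<Longrightarrow> (\<integral>\<omega>. B (S t \<omega>) \<omega> \<partial>M) = 0"
proof -
  interpret prob_space M by fact
  have nonneg: "0 \<le> S t \<omega>" if "\<omega> \<in> space M" for \<omega>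
    by (rule subordinator_nonneg[OF S t that])
  have cont: "continuous_on {0..} (\<lambda>t. B t \<omega>)" if "\<omega> \<in> space M" for \<omega>
    using fbm that by (simp add: fractional_brownian_motion_def)
  note R = nn_integral_process_at_random_time[OF M indep t nonneg cont]
  note marg = fractional_brownian_motion_marginal[OF M fbm]
  show meas [measurable]: "(\<lambda>\<omega>. B (S t \<omega>) \<omega>) \<in> borel_measurable M"
    by (rule R(1))
  show "(\<integral>\<^sup>+\<omega>. ennreal ((B (S t \<omega>) \<omega>)\<^sup>2) \<partial>M) = (\<integral>\<^sup>+\<omega>. ennreal (S t \<omega> powr (2 * H)) \<partial>M)"
  proof -
    have "(\<integral>\<^sup>+\<omega>. ennreal ((B (S t \<omega>) \<omega>)\<^sup>2) \<partial>M)
        = (\<integral>\<^sup>+\<omega>'. (\<integral>\<^sup>+\<omega>. ennreal ((B (S t \<omega>') \<omega>)\<^sup>2) \<partial>M) \<partial>M)"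
      by (rule R(2)[where h = "\<lambda>x. ennreal (x\<^sup>2)"]) measurable
    also have "\<dots> = (\<integral>\<^sup>+\<omega>. ennreal (S t \<omega> powr (2 * H)) \<partial>M)"
      by (intro nn_integral_cong marg(4) nonneg)
    finally show ?thesis .
  qed
  assume "integrable M (\<lambda>\<omega>. (B (S t \<omega>) \<omega>)\<^sup>2)"
  then have int: "integrable M (\<lambda>\<omega>. B (S t \<omega>) \<omega>)"
    by (rule square_integrable_imp_integrable[OF meas])
  have "(\<integral>\<^sup>+\<omega>. ennreal (B (S t \<omega>) \<omega>) \<partial>M) = (\<integral>\<^sup>+\<omega>'. (\<integral>\<^sup>+\<omega>. ennreal (B (S t \<omega>') \<omega>) \<partial>M) \<partial>M)"
    by (rule R(2)[where h = ennreal]) measurable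
  also have "\<dots> = (\<integral>\<^sup>+\<omega>'. (\<integral>\<^sup>+\<omega>. ennreal (- B (S t \<omega>') \<omega>) \<partial>M) \<partial>M)"
    by (intro nn_integral_cong integral_eq_0_iff_nn_integrals_eq[THEN iffD1] marg(2,3) nonneg)
  also have "\<dots> = (\<integral>\<^sup>+\<omega>. ennreal (- B (S t \<omega>) \<omega>) \<partial>M)"
    by (rule R(2)[symmetric, where h = "\<lambda>x. ennreal (- x)"]) measurable
  finally show "(\<integral>\<omega>. B (S t \<omega>) \<omega> \<partial>M) = 0"
    by (rule integral_eq_0_iff_nn_integrals_eq[OF int, THEN iffD2])
qed

section \<open>Fractional moments of the subordinator\<close>

lemma nn_integral_powr_if_laplace_tempered:
  fixes X :: "'a \<Rightarrow> real"
  assumes M: "prob_space M" and X: "X \<in> borel_measurable M" "\<And>\<omega>. \<omega> \<in> space M \<Longrightarrow> 0 \<le> X \<omega>"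
    and lap: "\<And>u. u > 0 \<Longrightarrow>
      (LINT \<omega>|M. exp (- u * X \<omega>)) = exp (- (t * (a * lower_incomplete_gamma a u)))"
    and p: "0 < p" "p < 1" and t: "0 < t"
  shows "p < a \<Longrightarrow> (\<integral>\<^sup>+\<omega>. ennreal (X \<omega> powr p) \<partial>M)
      = ennreal ((LINT u|lborel. frac_kernel p (rescaled_exponent a t) u)
          / (LINT u|lborel. frac_kernel p (\<lambda>u. u) u) * t powr (p / a))"
    and "p = a \<Longrightarrow> (\<integral>\<^sup>+\<omega>. ennreal (X \<omega> powr p) \<partial>M) = \<infinity>"
proof -
  define c where "c = (LINT u|lborel. frac_kernel p (\<lambda>u. u) u)"
  \<comment> \<open>Here p < 1 enters: the identity is bounded by u^1, so the integrability
    criterion applies with exponent 1.\<close>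
  have ic: "integrable lborel (frac_kernel p (\<lambda>u. u))"
    using p by (intro integrable_frac_kernel[of p 1]) auto
  have c: "0 < c"
    unfolding c_def by (rule integral_frac_kernel_pos[OF ic])
  have "(\<integral>\<^sup>+u. frac_kernel p (\<lambda>u. u) u \<partial>lborel) = ennreal c"
    unfolding c_def
    by (rule nn_integral_eq_integral[OF ic]) (intro always_eventually allI frac_kernel_nonneg, simp)
  then have moment: "(\<integral>\<^sup>+\<omega>. ennreal (X \<omega> powr p) \<partial>M) * ennreal c
      = (\<integral>\<^sup>+u. frac_kernel p (\<lambda>u. t * (a * lower_incomplete_gamma a u)) u \<partial>lborel)"
    using nn_integral_powr_via_laplace[OF M X lap, of p] by simp
  show "(\<integral>\<^sup>+\<omega>. ennreal (X \<omega> powr p) \<partial>M) = \<infinity>" if "p = a"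
  proof (rule ccontr)
    assume "(\<integral>\<^sup>+\<omega>. ennreal (X \<omega> powr p) \<partial>M) \<noteq> \<infinity>"
    then have "(\<integral>\<^sup>+\<omega>. ennreal (X \<omega> powr p) \<partial>M) * ennreal c < \<infinity>"
      by (simp add: ennreal_mult_less_top less_top)
    then show False
      unfolding moment using nn_integral_frac_kernel_tempered_infinite[of a t] that p t by simp
  qed
  assume a: "p < a"
  define I where "I = (LINT u|lborel. frac_kernel p (rescaled_exponent a t) u)"
  have a0: "0 < a" using p a by simp
  note bounds = rescaled_exponent_bounds[OF a0 t]
  have iI: "integrable lborel (frac_kernel p (rescaled_exponent a t))"
    by (intro integrable_frac_kernel[OF p(1) a] bounds) measurable
  have nonneg: "0 \<le> frac_kernel p (rescaled_exponent a t) u" for u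
    by (intro frac_kernel_nonneg bounds)
  \<comment> \<open>Scaling by t^(-1/a) produces the factor t^(-p/a), which becomes the growth
    t^(p/a) of the moment.\<close>
  have "ennreal I = (\<integral>\<^sup>+u. frac_kernel p (rescaled_exponent a t) u \<partial>lborel)"
    unfolding I_def using nonneg by (intro nn_integral_eq_integral[symmetric] iI) auto
  also have "\<dots> = ennreal ((t powr (- 1 / a)) powr p)
      * (\<integral>\<^sup>+u. frac_kernel p (\<lambda>u. t * (a * lower_incomplete_gamma a u)) u \<partial>lborel)"
    using nn_integral_frac_kernel_scale
        [of "\<lambda>u. t * (a * lower_incomplete_gamma a u)" "t powr (- 1 / a)" p] t
    by (simp add: rescaled_exponent_def[abs_def])
  finally have I_eq: "ennreal I = ennreal (t powr (- (p / a)))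
      * ((\<integral>\<^sup>+\<omega>. ennreal (X \<omega> powr p) \<partial>M) * ennreal c)"
    unfolding moment by (simp add: powr_powr)
  have I0: "0 \<le> I" unfolding I_def using nonneg by (intro integral_nonneg_AE) auto
  \<comment> \<open>The moment is not yet known to be finite, so the constants are gathered into one
    real factor equal to 1 and nothing is divided in \<open>ennreal\<close>.\<close>
  have unit: "t powr (p / a) / c * (t powr (- (p / a)) * c) = 1"
    using t c by (simp add: powr_minus)
  have "ennreal (I / c * t powr (p / a)) = ennreal (t powr (p / a) / c) * ennreal I"
    using I0 c by (simp add: ennreal_mult'[symmetric] mult.commute)
  also have "\<dots> = ennreal (t powr (p / a) / c * (t powr (- (p / a)) * c))
      * (\<integral>\<^sup>+\<omega>. ennreal (X \<omega> powr p) \<partial>M)"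
    unfolding I_eq using c by (simp only: ennreal_mult' less_imp_le powr_ge_zero divide_nonneg_pos ac_simps)
  finally show "(\<integral>\<^sup>+\<omega>. ennreal (X \<omega> powr p) \<partial>M)
      = ennreal (I / c * t powr (p / a))"
    unfolding unit by simp
qed

section \<open>Variance asymptotics and subdiffusion\<close>

theorem mainTheorem10:
  fixes H \<alpha> :: real
  assumes "0 < H" and "H < 1/2" and "0 < \<alpha>" and "\<alpha> \<le> 1" and "2 * H \<le> \<alpha>"
  shows "(\<exists>K>0. \<forall>(M :: 'a measure) B S Z.
      prob_space M \<longrightarrow>
      fractional_brownian_motion M H B \<longrightarrow>
      subordinator M S \<longrightarrow>
      independent_processes M B S \<longrightarrow>
      (\<forall>\<eta>\<ge>0. \<forall>t\<ge>0. prob_space.expectation M (\<lambda>\<omega>. exp (- \<eta> * S t \<omega>))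
                      = exp (- t * \<alpha> * lower_incomplete_gamma \<alpha> \<eta>)) \<longrightarrow>
      Z = (\<lambda>t \<omega>. B (S t \<omega>) \<omega>) \<longrightarrow>
      (2 * H < \<alpha> \<longrightarrow>
         (\<lambda>t. prob_space.variance M (Z t)) \<sim>[at_top] (\<lambda>t. K * t powr (2 * H / \<alpha>)) \<and>
         has_msd_exponent M Z (2 * H / \<alpha>) \<and>
         subdiffusive M Z) \<and>
      (2 * H = \<alpha> \<longrightarrow> (\<forall>t>0. (\<integral>\<^sup>+\<omega>. ennreal ((Z t \<omega>)\<^sup>2) \<partial>M) = \<infinity>))) \<and>
    (2 * H < \<alpha> \<longrightarrow> 2 * H / \<alpha> < 1) \<and>
    strict_antimono_on {2 * H..1} (\<lambda>a. 2 * H / a)"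
proof (intro conjI)
  define p where "p = 2 * H"
  have p: "0 < p" "p < 1" "p \<le> \<alpha>" using assms by (auto simp: p_def)
  define I where "I t = (LINT u|lborel. frac_kernel p (rescaled_exponent \<alpha> t) u)" for t
  define c where "c = (LINT u|lborel. frac_kernel p (\<lambda>u. u) u)"
  define L where "L = (LINT u|lborel. frac_kernel p (\<lambda>u. u powr \<alpha>) u)"
  \<comment> \<open>For p < \<alpha> this is Gamma(1 - p/\<alpha>) / Gamma(1 - p). It is fixed
    before the processes and so depends on H and \<alpha> alone. When p = \<alpha> only K > 0 is
    claimed, and 1 serves.\<close>
  define K where "K = (if p < \<alpha> then L / c else 1)"
  have "0 < c"
    unfolding c_def using p by (intro integral_frac_kernel_pos integrable_frac_kernel[of p 1]) auto
  have "0 < L" if "p < \<alpha>"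
    unfolding L_def using that p
    by (intro integral_frac_kernel_pos integrable_frac_kernel[of p \<alpha>]) auto
  with \<open>0 < c\<close> have "0 < K" by (simp add: K_def)
  have asymp: "(\<lambda>t. I t / c * t powr (p / \<alpha>)) \<sim>[at_top] (\<lambda>t. K * t powr (p / \<alpha>))" if "p < \<alpha>"
  proof (rule asymp_equiv_mult[OF tendsto_imp_asymp_equiv_const asymp_equiv_refl])
    show "((\<lambda>t. I t / c) \<longlongrightarrow> K) at_top"
      using tendsto_integral_frac_kernel_rescaled_exponent[OF p(1) that] that \<open>0 < c\<close>
      unfolding I_def L_def K_def by (auto intro!: tendsto_divide)
  qed (use \<open>0 < K\<close> in simp)
  show "\<exists>K>0. \<forall>(M :: 'a measure) B S Z.
      prob_space M \<longrightarrow>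
      fractional_brownian_motion M H B \<longrightarrow>
      subordinator M S \<longrightarrow>
      independent_processes M B S \<longrightarrow>
      (\<forall>\<eta>\<ge>0. \<forall>t\<ge>0. prob_space.expectation M (\<lambda>\<omega>. exp (- \<eta> * S t \<omega>))
                      = exp (- t * \<alpha> * lower_incomplete_gamma \<alpha> \<eta>)) \<longrightarrow>
      Z = (\<lambda>t \<omega>. B (S t \<omega>) \<omega>) \<longrightarrow>
      (2 * H < \<alpha> \<longrightarrow>
         (\<lambda>t. prob_space.variance M (Z t)) \<sim>[at_top] (\<lambda>t. K * t powr (2 * H / \<alpha>)) \<and>
         has_msd_exponent M Z (2 * H / \<alpha>) \<and>
         subdiffusive M Z) \<and>
      (2 * H = \<alpha> \<longrightarrow> (\<forall>t>0. (\<integral>\<^sup>+\<omega>. ennreal ((Z t \<omega>)\<^sup>2) \<partial>M) = \<infinity>))"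
    unfolding p_def[symmetric]
  proof (intro exI[of _ K] conjI allI impI \<open>0 < K\<close>)
    fix M :: "'a measure" and B S Z
    assume M: "prob_space M" and fbm: "fractional_brownian_motion M H B"
      and S: "subordinator M S" and indep: "independent_processes M B S"
      and lap: "\<forall>\<eta>\<ge>0. \<forall>t\<ge>0. prob_space.expectation M (\<lambda>\<omega>. exp (- \<eta> * S t \<omega>))
                      = exp (- t * \<alpha> * lower_incomplete_gamma \<alpha> \<eta>)"
      and Z: "Z = (\<lambda>t \<omega>. B (S t \<omega>) \<omega>)"
    interpret prob_space M by fact
    have S_meas: "S t \<in> borel_measurable M" if "0 \<le> t" for t
      using S that by (simp add: subordinator_def levy_process_def)
    note Z_moments = subordinated_fbm_moments[OF M fbm S indep, folded p_def]
    have Z_meas: "Z t \<in> borel_measurable M" if "0 \<le> t" for t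
      unfolding Z by (rule Z_moments(1)[OF that])
    have S_lap: "expectation (\<lambda>\<omega>. exp (- u * S t \<omega>)) = exp (- (t * (\<alpha> * lower_incomplete_gamma \<alpha> u)))"
      if "0 < u" "0 < t" for t u
      using lap that by (simp add: mult.assoc)
    note S_moment = nn_integral_powr_if_laplace_tempered
      [OF M S_meas[OF less_imp_le] subordinator_nonneg[OF S less_imp_le] S_lap p(1,2)]
    \<comment> \<open>The block confines the boundary assumption p = \<alpha>; the goals after it
      assume p < \<alpha>.\<close>
    {
      fix t :: real assume "p = \<alpha>" "0 < t"
      then show "(\<integral>\<^sup>+\<omega>. ennreal ((Z t \<omega>)\<^sup>2) \<partial>M) = \<infinity>"
        using Z_moments(2)[of t] S_moment(2)[of t] by (simp add: Z)
    }
    assume "p < \<alpha>"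
    \<comment> \<open>A finite nonnegative integral yields integrability together with the value, so
      the expectation is not the default 0.\<close>
    have Z_sq: "integrable M (\<lambda>\<omega>. (Z t \<omega>)\<^sup>2)"
      "expectation (\<lambda>\<omega>. (Z t \<omega>)\<^sup>2) = I t / c * t powr (p / \<alpha>)" if t: "0 < t" for t
    proof -
      have "0 \<le> I t"
        unfolding I_def using rescaled_exponent_bounds(3)[OF assms(3) t]
        by (intro integral_nonneg_AE always_eventually allI frac_kernel_nonneg) auto
      then have nonneg: "0 \<le> I t / c * t powr (p / \<alpha>)" using \<open>0 < c\<close> by simp
      have eq: "(\<integral>\<^sup>+\<omega>. ennreal ((Z t \<omega>)\<^sup>2) \<partial>M) = ennreal (I t / c * t powr (p / \<alpha>))"
        using Z_moments(2)[of t] S_moment(1)[of t] t \<open>p < \<alpha>\<close> by (simp add: Z I_def c_def)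
      show "integrable M (\<lambda>\<omega>. (Z t \<omega>)\<^sup>2)"
        by (rule integrableI_nn_integral_finite[OF _ _ eq]) (use Z_meas[of t] t nonneg in auto)
      show "expectation (\<lambda>\<omega>. (Z t \<omega>)\<^sup>2) = I t / c * t powr (p / \<alpha>)"
        by (subst integral_eq_nn_integral) (use Z_meas[of t] t nonneg eq in auto)
    qed
    have var: "variance (Z t) = I t / c * t powr (p / \<alpha>)" if "0 < t" for t
    proof -
      have "expectation (Z t) = 0"
        using Z_moments(3)[of t] Z_sq(1)[OF that] that unfolding Z by simp
      then show ?thesis using Z_sq(2)[OF that] by simp
    qed
    show "(\<lambda>t. variance (Z t)) \<sim>[at_top] (\<lambda>t. K * t powr (p / \<alpha>))"
      by (rule asymp_equiv_cong[THEN iffD1, OF _ _ asymp[OF \<open>p < \<alpha>\<close>]])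
         (auto intro!: eventually_mono[OF eventually_gt_at_top[of 0]] simp only: var)
    \<comment> \<open>The displacement subtracts \<open>Z 0\<close>. Since B(0) has second moment
      \<open>0 powr (2 * H) = 0\<close>, it vanishes almost surely, while S(0) = 0 on every
      path.\<close>
    have "AE \<omega> in M. B 0 \<omega> = 0"
      using fractional_brownian_motion_marginal(1,4)[OF M fbm, of 0]
      by (simp add: nn_integral_0_iff_AE)
    moreover have "S 0 \<omega> = 0" if "\<omega> \<in> space M" for \<omega>
      using S that by (simp add: subordinator_def levy_process_def)
    ultimately have Z0: "AE \<omega> in M. Z 0 \<omega> = 0"
      unfolding Z by (auto elim!: AE_mp intro!: AE_I2)
    have msd: "mean_square_displacement M Z t = I t / c * t powr (p / \<alpha>)" if "0 < t" for t
      unfolding mean_square_displacement_def Z_sq(2)[OF that, symmetric]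
    proof (rule integral_cong_AE)
      show "AE \<omega> in M. (Z t \<omega> - Z 0 \<omega>)\<^sup>2 = (Z t \<omega>)\<^sup>2"
        using Z0 by eventually_elim simp
    qed (use Z_meas[of t] Z_meas[of 0] that in auto)
    have "mean_square_displacement M Z \<sim>[at_top] (\<lambda>t. K * t powr (p / \<alpha>))"
      by (rule asymp_equiv_cong[THEN iffD1, OF _ _ asymp[OF \<open>p < \<alpha>\<close>]])
         (auto intro!: eventually_mono[OF eventually_gt_at_top[of 0]] simp only: msd)
    then show exponent: "has_msd_exponent M Z (p / \<alpha>)"
      unfolding has_msd_exponent_def using \<open>0 < K\<close> by blast
    have "0 < p / \<alpha>" "p / \<alpha> < 1" using p \<open>p < \<alpha>\<close> by auto
    then show "subdiffusive M Z"
      unfolding subdiffusive_def using exponent by blast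
  qed
  show "2 * H < \<alpha> \<longrightarrow> 2 * H / \<alpha> < 1" using assms by simp
  \<comment> \<open>The interval is the range of admissible \<alpha> for fixed H: a larger \<alpha>
    gives a smaller exponent, hence a more marked subdiffusion.\<close>
  show "strict_antimono_on {2 * H..1} (\<lambda>a. 2 * H / a)"
    using \<open>0 < H\<close> by (auto simp: monotone_on_def intro!: divide_strict_left_mono)
qed

end
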